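(* Let $\mathbb{F}$ be a finite field. Then $\omega(TD(\mathbb{F},2))=2$ if $|\mathbb{F}|\equiv 3\pmod 4$, and $\omega(TD(\mathbb{F},2))=|\mathbb{F}|-1$ otherwise. Also, for the independence number, $$\alpha(TD(\mathbb{F},2))=\frac{O(\mathbb{F},2)}{|\mathbb{F}|-1}+\frac{(|\mathbb{F}|^2-1)-O(\mathbb{F},2)}{2}\ \text{ if } O(\mathbb{F},2)\neq 0,\qquad \alpha(TD(\mathbb{F},2))=\frac{|\mathbb{F}|^2-1}{2}\ \text{ otherwise.}$$
   Context: For a commutative ring $R$ with nonzero identity and an integer $n\ge1$, $TD(R,n)$ is the simple graph with vertex set $R^n\setminus\{(0,\ldots,0)\}$ in which two distinct vertices $\mathbf{x},\mathbf{y}$ are adjacent if and only if $\mathbf{x}\cdot\mathbf{y}=\sum_{i=1}^n x_iy_i=0$ in $R$. $\omega(G)$ is the clique number (largest size of a set of pairwise adjacent vertices) and $\alpha(G)$ the independence number (largest size of a set of pairwise non-adjacent vertices) of a graph $G$. $O(R,n)$ denotes the number of non-trivial (i.e. nonzero) solutions $(x_1,\ldots,x_n)\in R^n$ of $x_1^2+\cdots+x_n^2=0$.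
   Formalization: The clique number formula |F|-1 is stated only for |F| different from 2, since for |F|=2 the vertices (1,0) and (0,1) are adjacent, so the clique number is 2 and not |F|-1=1. *)

theory Defs
  imports "HOL-Analysis.Analysis" "HOL-Library.Ramsey"
begin

type_synonym 'v sgraph = "'v set \<times> 'v set set"

text \<open>
  The predicates \<^const>\<open>clique\<close> and \<^const>\<open>indep\<close> of Ramsey theory constrain only the pairs inside
  their first argument, so the inclusion in the vertex set is added. The two numbers are meaningful
  for graphs with finitely many vertices; there the empty set guarantees that the maximum exists.
\<close>

definition clique_number :: "'v sgraph \<Rightarrow> nat" where
  "clique_number G = Max {card C | C. C \<subseteq> fst G \<and> finite C \<and> clique C (snd G)}"

definition independence_number :: "'v sgraph \<Rightarrow> nat" where
  "independence_number G = Max {card C | C. C \<subseteq> fst G \<and> finite C \<and> indep C (snd G)}"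

text \<open>
  The inner product of HOL-Analysis exists only over the reals, so the dot product over a
  commutative ring is defined here.
\<close>

definition dot_prod :: "'a::comm_ring_1 ^ 'n \<Rightarrow> 'a ^ 'n \<Rightarrow> 'a" where
  "dot_prod x y = (\<Sum>i\<in>UNIV. x $ i * y $ i)"

definition TD :: "('a::comm_ring_1 ^ 'n) sgraph" where
  "TD = (UNIV - {0},
         {{x, y} | x y. x \<noteq> 0 \<and> y \<noteq> 0 \<and> x \<noteq> y \<and> dot_prod x y = 0})"

text \<open>\<open>O(R, n)\<close>, where the type argument stands for \<open>R\<^sup>n\<close>.\<close>

definition num_isotropic :: "('a::comm_ring_1 ^ 'n) itself \<Rightarrow> nat" where
  "num_isotropic _ = card {x :: 'a ^ 'n. x \<noteq> 0 \<and> (\<Sum>i\<in>UNIV. (x $ i)\<^sup>2) = 0}"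

end

theory Submission
  imports Defs
begin

text \<open>
  Let \<open>q\<close> be the size of the field. The plane has a quarter turn
  \<open>(a, b) \<mapsto> (-b, a)\<close>, and two nonzero vectors are orthogonal exactly when the second lies on the
  line through the turned first one (\<open>orthogonal_iff_on_rot_line\<close>). So the whole graph is described by
  the action of the quarter turn on the lines through the origin, each of which carries \<open>q - 1\<close>
  vertices. On lines the quarter turn is an involution. A fixed line consists of isotropic vectors
  and is a complete graph with no edges leaving it. Every other line forms, together with its
  image, a complete bipartite graph, again with no edges leaving it.

  Cliques: a bipartite component contributes cliques of size 2, and an isotropic line is a clique of
  size \<open>q - 1\<close> (\<open>clique_TD_cases\<close>). Isotropic lines exist exactly if \<open>-1\<close> is a square, that is,
  if \<open>q\<close> is not \<open>3\<close> modulo \<open>4\<close> (\<open>minus_one_square_iff\<close>). Apart from \<open>q = 2\<close>, this means \<open>q \<ge> 4\<close>, and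
  then \<open>q - 1\<close> exceeds 2.

  Independent sets: the best choice is one vector on every isotropic line together with one full
  line out of each pair of lines that the quarter turn exchanges, hence half of the
  anisotropic vectors (\<open>double_independence_number_TD\<close>). Since the \<open>q - 1\<close> nonzero vectors of an
  isotropic line are all isotropic, the number of isotropic lines is the number of nonzero isotropic
  vectors divided by \<open>q - 1\<close>.
\<close>

section \<open>Squares and parity in a finite field\<close>

text \<open>
  The orbits of a fixed-point free involution are pairs. An arbitrary injective ranking of the
  elements selects the lower-ranked one of each pair. The result serves twice: for parity arguments
  in the field, and to pick one line out of each orthogonal pair.
\<close>

lemma involution_transversal:
  assumes "finite S" and closed: "\<And>x. x \<in> S \<Longrightarrow> f x \<in> S"
    and invol: "\<And>x. x \<in> S \<Longrightarrow> f (f x) = x" and free: "\<And>x. x \<in> S \<Longrightarrow> f x \<noteq> x"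
  obtains H where "H \<inter> f ` H = {}" "S = H \<union> f ` H" "card S = 2 * card H"
proof -
  obtain r :: "'a \<Rightarrow> nat" where inj: "inj_on r S"
    using finite_imp_inj_to_nat_seg[OF \<open>finite S\<close>] by blast
  define H where "H = {x \<in> S. r x < r (f x)}"
  have dis: "H \<inter> f ` H = {}"
    unfolding H_def using invol by force
  have "x \<in> H \<union> f ` H" if "x \<in> S" for x
  proof (cases "r x < r (f x)")
    case False
    then have "r (f x) < r x"
      using inj_onD[OF inj, of x "f x"] closed free that by (metis linorder_neqE_nat)
    then have "f x \<in> H" using that closed invol unfolding H_def by auto
    then show ?thesis using invol[OF that] by (metis UnI2 imageI)
  qed (use that in \<open>auto simp: H_def\<close>)
  then have un: "S = H \<union> f ` H" unfolding H_def using closed by auto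
  have "inj_on f H"
    by (rule inj_on_inverseI[of _ f]) (auto simp: H_def invol)
  then have "card S = 2 * card H"
    using un dis \<open>finite S\<close> by (metis card_Un_disjoint card_image finite_Un mult_2)
  with dis un that show ?thesis by blast
qed

lemma two_le_CARD_field: "2 \<le> CARD('a::{field,finite})"
proof -
  have "card {0::'a, 1} \<le> CARD('a)" by (rule card_mono) auto
  then show ?thesis by simp
qed

text \<open>
  In characteristic 2 the translation by 1 pairs off all elements. In any other characteristic,
  negation pairs off the nonzero ones and leaves 0 alone.
\<close>

lemma even_CARD_iff_char_2: "even CARD('a::{field,finite}) \<longleftrightarrow> (1::'a) + 1 = 0"
proof
  assume "(1::'a) + 1 = 0"
  then have "x + 1 + 1 = x" for x :: 'a by (simp add: add.assoc)
  then obtain H :: "'a set" where "CARD('a) = 2 * card H"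
    using involution_transversal[of "UNIV :: 'a set" "\<lambda>x. x + 1"]
    by (metis UNIV_I add_cancel_right_right finite_code zero_neq_one)
  then show "even CARD('a)" by simp
next
  assume ev: "even CARD('a)"
  show "(1::'a) + 1 = 0"
  proof (rule ccontr)
    assume two: "(1::'a) + 1 \<noteq> 0"
    have "- x \<noteq> x" if "x \<noteq> 0" for x :: 'a
    proof
      assume "- x = x"
      then have "x + x = 0" by (simp add: neg_eq_iff_add_eq_0)
      then have "(1 + 1) * x = 0" by (simp only: distrib_right mult_1)
      with two that show False by (simp only: mult_eq_0_iff simp_thms)
    qed
    then obtain H :: "'a set" where "card (UNIV - {0::'a}) = 2 * card H"
      using involution_transversal[of "UNIV - {0::'a}" uminus]
      by (metis DiffD1 DiffD2 DiffI UNIV_I finite_code minus_minus neg_equal_0_iff_equal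
          singleton_iff)
    moreover have "CARD('a) = Suc (card (UNIV - {0::'a}))"
      by (rule card.remove) auto
    ultimately have "CARD('a) = Suc (2 * card H)" by (simp only:)
    with ev show False by simp
  qed
qed

text \<open>
  Multiplication by \<open>a\<close> permutes the nonzero elements, so it does not change their product, although
  it multiplies it by one factor \<open>a\<close> for each of them.
\<close>

lemma field_power_CARD_minus_1:
  fixes a :: "'a::{field,finite}"
  assumes "a \<noteq> 0"
  shows "a ^ (CARD('a) - 1) = 1"
proof -
  let ?U = "UNIV - {0::'a}"
  have "bij_betw ((*) a) ?U ?U"
    by (rule bij_betwI[where g = "\<lambda>x. x / a"]) (use assms in auto)
  then have "prod (\<lambda>x. x) ?U = (\<Prod>x\<in>?U. a * x)"
    by (rule prod.reindex_bij_betw[symmetric])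
  also have "\<dots> = a ^ card ?U * prod (\<lambda>x. x) ?U"
    by (simp add: prod.distrib)
  finally show ?thesis by (simp add: card_Diff_singleton)
qed

text \<open>
  A square root \<open>i\<close> of \<open>-1\<close> would, for \<open>q = 4k + 3\<close>, give
  \<open>1 = i ^ (q - 1) = (-1) ^ (2k + 1) = -1\<close>, which odd order forbids. Conversely, in characteristic 2
  the element 1 is such a root. For \<open>q = 4k + 1\<close> the equation \<open>x ^ (2k) = 1\<close> has too few
  roots to hold for all \<open>4k\<close> nonzero elements. Where it fails, \<open>x ^ (2k)\<close> is the other square root
  \<open>-1\<close> of 1, so \<open>x ^ k\<close> is the root wanted.
\<close>

lemma minus_one_square_iff:
  "(\<exists>i::'a::{field,finite}. i\<^sup>2 = -1) \<longleftrightarrow> CARD('a) mod 4 \<noteq> 3"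
proof
  assume "\<exists>i::'a. i\<^sup>2 = -1"
  then obtain i :: 'a where i: "i\<^sup>2 = -1" ..
  show "CARD('a) mod 4 \<noteq> 3"
  proof
    assume m: "CARD('a) mod 4 = 3"
    define k where "k = CARD('a) div 4"
    have q: "CARD('a) = 4 * k + 3" using m unfolding k_def by presburger
    have "i \<noteq> 0" using i by auto
    then have "1 = i ^ (2 * (2 * k + 1))"
      using field_power_CARD_minus_1[of i] q by (simp add: algebra_simps)
    also have "\<dots> = -1" unfolding power_mult i by simp
    finally have "(1::'a) + 1 = 0" by (metis add.right_inverse)
    then show False using q even_CARD_iff_char_2[where 'a='a] by simp
  qed
next
  assume m: "CARD('a) mod 4 \<noteq> 3"
  show "\<exists>i::'a. i\<^sup>2 = -1"
  proof (cases "even CARD('a)")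
    case True
    then have "(1::'a)\<^sup>2 = -1"
      using even_CARD_iff_char_2[where 'a='a] by (simp add: eq_neg_iff_add_eq_0)
    then show ?thesis ..
  next
    case False
    define k where "k = CARD('a) div 4"
    have q: "CARD('a) = 4 * k + 1" using m False unfolding k_def by presburger
    have k: "k > 0" using two_le_CARD_field[where 'a='a] q by simp
    define p :: "'a poly" where "p = monom 1 (2 * k) - 1"
    have "coeff p (2 * k) = 1" using k by (simp add: p_def)
    then have "p \<noteq> 0" by auto
    then have "card {x. poly p x = 0} \<le> degree p" by (rule card_poly_roots_bound)
    also have "degree p \<le> 2 * k" unfolding p_def
      by (rule degree_diff_le) (auto simp: degree_monom_le)
    also have "\<dots> < card (UNIV - {0::'a})" using q k by (simp add: card_Diff_singleton)
    finally have "\<not> UNIV - {0} \<subseteq> {x. poly p x = 0}" by (metis card_mono finite_code not_le)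
    then obtain x :: 'a where x: "x \<noteq> 0" "x ^ (2 * k) \<noteq> 1"
      by (auto simp: p_def poly_monom)
    have "(x ^ (2 * k))\<^sup>2 = 1"
      using field_power_CARD_minus_1[OF x(1)] q by (simp add: power_mult[symmetric] mult.commute)
    then have "(x ^ k)\<^sup>2 = -1"
      using x(2) power2_eq_1_iff[of "x ^ (2 * k)"] by (metis mult.commute power_mult)
    then show ?thesis ..
  qed
qed

section \<open>Orthogonality in the plane\<close>

definition rot :: "'a::comm_ring_1 ^ 2 \<Rightarrow> 'a ^ 2" where
  "rot x = vector [- x $ 2, x $ 1]"

text \<open>
  For \<open>x \<noteq> 0\<close> this is the line through the origin and \<open>x\<close> without the origin, so that the
  lines partition the vertex set of the graph.
\<close>

definition punctured_line :: "'a::field ^ 2 \<Rightarrow> ('a ^ 2) set" where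
  "punctured_line x = {c *s x | c. c \<noteq> 0}"

definition isotropic :: "'a::comm_ring_1 ^ 2 \<Rightarrow> bool" where
  "isotropic x \<longleftrightarrow> dot_prod x x = 0"

lemmas plane_simps = dot_prod_def rot_def sum_2 vec_eq_iff forall_2 vector_2
  vector_smult_component

lemma dot_prod_commute: "dot_prod x y = dot_prod y x"
  by (simp add: dot_prod_def mult.commute)

lemma dot_prod_scale [simp]:
  "dot_prod (c *s x) y = c * dot_prod x y" "dot_prod x (c *s y) = c * dot_prod x y"
  by (simp_all add: dot_prod_def sum_distrib_left ac_simps)

lemma rot_rot: "rot (rot x) = - x"
  by (simp add: plane_simps)

lemma rot_scale: "rot (c *s x) = c *s rot x"
  by (simp add: plane_simps)

lemma rot_eq_0_iff [simp]: "rot x = 0 \<longleftrightarrow> x = 0"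
  by (auto simp: plane_simps)

lemma inj_on_rot: "inj_on rot S"
  by (rule inj_on_inverseI[of _ "\<lambda>x. - rot x"]) (simp add: rot_rot)

lemma dot_prod_rot_self [simp]: "dot_prod x (rot x) = 0"
  by (simp add: plane_simps)

lemma isotropic_rot_iff [simp]: "isotropic (rot x) \<longleftrightarrow> isotropic x"
  by (simp add: isotropic_def plane_simps add.commute)

lemma isotropic_scale_iff:
  fixes x :: "'a::field ^ 2"
  assumes "c \<noteq> 0"
  shows "isotropic (c *s x) \<longleftrightarrow> isotropic x"
  using assms by (simp add: isotropic_def)

text \<open>
  The orthogonal complement of a nonzero vector is a line, even over a field with isotropic vectors,
  and the turned vector spans it. The proof solves the equation \<open>x\<^sub>1 y\<^sub>1 + x\<^sub>2 y\<^sub>2 = 0\<close> for the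
  coordinate of \<open>y\<close> whose coefficient is nonzero.
\<close>

lemma orthogonal_iff_on_rot_line:
  fixes x y :: "'a::field ^ 2"
  assumes "x \<noteq> 0" "y \<noteq> 0"
  shows "dot_prod x y = 0 \<longleftrightarrow> y \<in> punctured_line (rot x)"
proof
  assume eq: "dot_prod x y = 0"
  have "\<exists>c. y = c *s rot x"
  proof (cases "x $ 1 = 0")
    case True
    then have "x $ 2 \<noteq> 0" using assms by (auto simp: plane_simps)
    with True eq have "y = (- y $ 1 / x $ 2) *s rot x"
      by (auto simp: plane_simps)
    then show ?thesis ..
  next
    case False
    from eq have "y $ 1 * x $ 1 = - (y $ 2 * x $ 2)"
      by (simp add: plane_simps eq_neg_iff_add_eq_0 mult.commute)
    with False have "y $ 1 = - (y $ 2 * x $ 2) / x $ 1"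
      by (simp only: nonzero_eq_divide_eq not_False_eq_True)
    with False have "y = (y $ 2 / x $ 1) *s rot x"
      by (simp add: plane_simps)
    then show ?thesis ..
  qed
  then show "y \<in> punctured_line (rot x)"
    using assms by (auto simp: punctured_line_def)
qed (auto simp: punctured_line_def)

lemma self_in_punctured_line: "x \<in> punctured_line x"
  unfolding punctured_line_def by (auto intro!: exI[of _ 1])

lemma punctured_line_eq:
  assumes "y \<in> punctured_line x"
  shows "punctured_line y = punctured_line x"
proof -
  obtain c where c: "c \<noteq> 0" "y = c *s x" using assms by (auto simp: punctured_line_def)
  have "d *s x = (d / c) *s y" for d using c by (simp add: vector_smult_assoc)
  then have "d *s x \<in> punctured_line y" if "d \<noteq> 0" for d
    unfolding punctured_line_def using c(1) that by (auto intro!: exI[of _ "d / c"])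
  then have "punctured_line x \<subseteq> punctured_line y"
    unfolding punctured_line_def by blast
  moreover have "punctured_line y \<subseteq> punctured_line x"
    unfolding punctured_line_def using c by (force simp: vector_smult_assoc)
  ultimately show ?thesis by blast
qed

lemma card_punctured_line:
  fixes x :: "'a::{field,finite} ^ 2"
  assumes "x \<noteq> 0"
  shows "card (punctured_line x) = CARD('a) - 1"
proof -
  have "punctured_line x = (\<lambda>c. c *s x) ` (UNIV - {0})"
    by (auto simp: punctured_line_def)
  moreover have "inj_on (\<lambda>c. c *s x) (UNIV - {0})"
    using assms by (auto simp: inj_on_def vec.scale_cancel_right)
  ultimately show ?thesis by (simp add: card_image card_Diff_singleton)
qed

lemma rot_image_punctured_line: "rot ` punctured_line x = punctured_line (rot x)"
  unfolding punctured_line_def by (force simp: rot_scale[symmetric])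

lemma punctured_line_uminus: "punctured_line (- x) = punctured_line x"
  by (rule punctured_line_eq) (auto simp: punctured_line_def intro!: exI[of _ "-1"])

lemma isotropic_iff_own_rot_line:
  fixes x :: "'a::field ^ 2"
  assumes "x \<noteq> 0"
  shows "isotropic x \<longleftrightarrow> punctured_line (rot x) = punctured_line x"
  unfolding isotropic_def orthogonal_iff_on_rot_line[OF assms assms]
  using self_in_punctured_line punctured_line_eq by metis

lemma isotropic_on_punctured_line:
  "y \<in> punctured_line x \<Longrightarrow> isotropic y \<longleftrightarrow> isotropic x"
  by (auto simp: punctured_line_def isotropic_scale_iff)

text \<open>
  Up to scaling, a nonzero isotropic vector has the form \<open>(i, 1)\<close> with \<open>i\<^sup>2 = -1\<close>.
\<close>

lemma ex_isotropic_iff: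
  "(\<exists>x::'a::{field,finite} ^ 2. x \<noteq> 0 \<and> isotropic x) \<longleftrightarrow> CARD('a) mod 4 \<noteq> 3"
proof -
  have "(\<exists>x::'a ^ 2. x \<noteq> 0 \<and> isotropic x) \<longleftrightarrow> (\<exists>i::'a. i\<^sup>2 = -1)"
  proof
    assume "\<exists>x::'a ^ 2. x \<noteq> 0 \<and> isotropic x"
    then obtain x :: "'a ^ 2" where x: "x \<noteq> 0" "x $ 1 * x $ 1 + x $ 2 * x $ 2 = 0"
      by (auto simp: isotropic_def dot_prod_def sum_2)
    then have "x $ 2 \<noteq> 0" by (auto simp: plane_simps)
    moreover have "x $ 1 * x $ 1 = - (x $ 2 * x $ 2)"
      using x(2) by (simp add: eq_neg_iff_add_eq_0)
    ultimately have "(x $ 1 / x $ 2)\<^sup>2 = -1"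
      by (simp add: power2_eq_square)
    then show "\<exists>i::'a. i\<^sup>2 = -1" ..
  next
    assume "\<exists>i::'a. i\<^sup>2 = -1"
    then obtain i :: 'a where "i\<^sup>2 = -1" ..
    then have "isotropic (vector [i, 1] :: 'a ^ 2)" "(vector [i, 1] :: 'a ^ 2) \<noteq> 0"
      by (auto simp: isotropic_def plane_simps power2_eq_square)
    then show "\<exists>x::'a ^ 2. x \<noteq> 0 \<and> isotropic x" by blast
  qed
  then show ?thesis by (simp add: minus_one_square_iff)
qed

section \<open>Cliques\<close>

lemma TD_edge_iff:
  "{x, y} \<in> snd TD \<longleftrightarrow> x \<noteq> 0 \<and> y \<noteq> 0 \<and> x \<noteq> y \<and> dot_prod x y = 0"
  by (auto simp: TD_def doubleton_eq_iff dot_prod_commute)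

lemma fst_TD: "fst TD = UNIV - {0}"
  by (simp add: TD_def)

text \<open>
  If a clique contains three vectors, then any two of them lie on the complement of the third, so
  they are proportional as well as orthogonal, and therefore isotropic. Once a clique contains an
  isotropic vector, everything orthogonal to it, hence the whole clique, lies on its line.
\<close>

lemma clique_TD_cases:
  fixes C :: "('a::{field,finite} ^ 2) set"
  assumes C: "C \<subseteq> fst TD" "clique C (snd TD)"
  shows "card C \<le> 2 \<or> (\<exists>y. y \<noteq> 0 \<and> isotropic y \<and> C \<subseteq> punctured_line y)"
proof (cases "card C \<le> 2")
  case False
  then have "3 \<le> card C" by simp
  then obtain D where "D \<subseteq> C" "card D = 3" by (rule obtain_subset_with_card_n)
  then obtain x y z where xyz: "x \<in> C" "y \<in> C" "z \<in> C" "x \<noteq> y" "x \<noteq> z" "y \<noteq> z"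
    unfolding card_3_iff by blast
  have ort: "dot_prod u v = 0" if "u \<in> C" "v \<in> C" "u \<noteq> v" for u v
    using C that unfolding clique_def TD_edge_iff by blast
  have nz: "u \<noteq> 0" if "u \<in> C" for u using that C(1) by (auto simp: fst_TD)
  \<comment> \<open>Both \<open>y\<close> and \<open>z\<close> span the complement of \<open>x\<close>, and \<open>z\<close> also spans that of \<open>y\<close>.\<close>
  have "y \<in> punctured_line (rot x)" "z \<in> punctured_line (rot x)"
    using orthogonal_iff_on_rot_line ort nz xyz by blast+
  then have "z \<in> punctured_line y" using punctured_line_eq by blast
  moreover have "z \<in> punctured_line (rot y)"
    using orthogonal_iff_on_rot_line ort nz xyz by blast
  ultimately have "punctured_line (rot y) = punctured_line y"
    using punctured_line_eq by blast
  then have iso: "isotropic y" "punctured_line (rot y) = punctured_line y"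
    using isotropic_iff_own_rot_line nz xyz by blast+
  have "u \<in> punctured_line y" if "u \<in> C" for u
  proof (cases "u = y")
    case False
    then show ?thesis
      using orthogonal_iff_on_rot_line[of y u] ort nz xyz iso(2) that by blast
  qed (simp add: self_in_punctured_line)
  with iso nz xyz show ?thesis by blast
qed simp

lemma clique_punctured_line:
  fixes y :: "'a::field ^ 2"
  assumes "y \<noteq> 0" "isotropic y"
  shows "punctured_line y \<subseteq> fst TD" "clique (punctured_line y) (snd TD)"
  using assms unfolding clique_def TD_edge_iff fst_TD isotropic_def punctured_line_def by auto

lemma clique_axes:
  "\<exists>C. C \<subseteq> fst TD \<and> clique C (snd (TD :: ('a::field ^ 2) sgraph)) \<and> card C = 2"
proof -
  let ?C = "{vector [1, 0], vector [0, 1]} :: ('a ^ 2) set"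
  have "?C \<subseteq> fst TD" "clique ?C (snd TD)" "card ?C = 2"
    by (auto simp: fst_TD clique_def TD_edge_iff plane_simps card_insert_if)
  then show ?thesis by blast
qed

lemma clique_number_eqI:
  fixes G :: "'v::finite sgraph"
  assumes "\<exists>C. C \<subseteq> fst G \<and> clique C (snd G) \<and> card C = n"
    and "\<And>C. C \<subseteq> fst G \<Longrightarrow> clique C (snd G) \<Longrightarrow> card C \<le> n"
  shows "clique_number G = n"
  unfolding clique_number_def by (rule Max_eqI) (use assms in auto)

lemma clique_number_TD_anisotropic:
  assumes "CARD('a::{field,finite}) mod 4 = 3"
  shows "clique_number (TD :: ('a ^ 2) sgraph) = 2"
proof (rule clique_number_eqI[OF clique_axes])
  fix C :: "('a ^ 2) set"
  assume "C \<subseteq> fst TD" "clique C (snd TD)"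
  then show "card C \<le> 2"
    using clique_TD_cases ex_isotropic_iff[where 'a='a] assms by blast
qed

lemma clique_number_TD_isotropic:
  assumes "CARD('a::{field,finite}) mod 4 \<noteq> 3" "CARD('a) \<noteq> 2"
  shows "clique_number (TD :: ('a ^ 2) sgraph) = CARD('a) - 1"
proof (rule clique_number_eqI)
  show "\<exists>C :: ('a ^ 2) set. C \<subseteq> fst TD \<and> clique C (snd TD) \<and> card C = CARD('a) - 1"
    using ex_isotropic_iff[where 'a='a] assms(1) clique_punctured_line card_punctured_line
    by blast
  have "CARD('a) \<ge> 3" using two_le_CARD_field[where 'a='a] assms by simp
  fix C :: "('a ^ 2) set"
  assume "C \<subseteq> fst TD" "clique C (snd TD)"
  from clique_TD_cases[OF this] show "card C \<le> CARD('a) - 1"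
  proof
    assume "\<exists>y. y \<noteq> 0 \<and> isotropic y \<and> C \<subseteq> punctured_line y"
    then show ?thesis by (metis card_mono card_punctured_line finite_code)
  qed (use \<open>CARD('a) \<ge> 3\<close> in simp)
qed

section \<open>Independent sets\<close>

lemma independence_number_eqI:
  fixes G :: "'v::finite sgraph"
  assumes "\<exists>C. C \<subseteq> fst G \<and> indep C (snd G) \<and> card C = n"
    and "\<And>C. C \<subseteq> fst G \<Longrightarrow> indep C (snd G) \<Longrightarrow> card C \<le> n"
  shows "independence_number G = n"
  unfolding independence_number_def by (rule Max_eqI) (use assms in auto)

lemma num_isotropic_eq_card:
  "num_isotropic TYPE('a::comm_ring_1 ^ 2) = card {x :: 'a ^ 2. x \<noteq> 0 \<and> isotropic x}"
  by (simp add: num_isotropic_def isotropic_def dot_prod_def power2_eq_square)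

lemma num_isotropic_eq_lines:
  "num_isotropic TYPE('a::{field,finite} ^ 2) =
     (CARD('a) - 1) * card (punctured_line ` {x :: 'a ^ 2. x \<noteq> 0 \<and> isotropic x})"
proof -
  let ?I = "{x :: 'a ^ 2. x \<noteq> 0 \<and> isotropic x}"
  have un: "\<Union> (punctured_line ` ?I) = ?I"
    using self_in_punctured_line clique_punctured_line(1) isotropic_on_punctured_line
    by (fastforce simp: fst_TD)
  have "(CARD('a) - 1) * card (punctured_line ` ?I) = card (\<Union> (punctured_line ` ?I))"
  proof (rule card_partition)
    fix l m assume "l \<in> punctured_line ` ?I" "m \<in> punctured_line ` ?I" "l \<noteq> m"
    then show "l \<inter> m = {}" using punctured_line_eq by blast
  qed (auto simp: card_punctured_line)
  then show ?thesis by (simp add: un num_isotropic_eq_card)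
qed

lemma indep_TD_iff:
  fixes C :: "('a::comm_ring_1 ^ 2) set"
  assumes "C \<subseteq> fst TD"
  shows "indep C (snd TD) \<longleftrightarrow> (\<forall>x\<in>C. \<forall>y\<in>C. x \<noteq> y \<longrightarrow> dot_prod x y \<noteq> 0)"
  using assms unfolding indep_def TD_edge_iff fst_TD by blast

text \<open>
  An independent set meets each isotropic line at most once, because such a line is a clique. An
  anisotropic vector is adjacent to its quarter turn, so the anisotropic members of an
  independent set and their turned copies are disjoint sets of anisotropic vectors of equal size.
\<close>

lemma card_indep_TD_le:
  fixes C :: "('a::{field,finite} ^ 2) set"
  assumes C: "C \<subseteq> fst TD" "indep C (snd TD)"
  shows "2 * card C \<le> 2 * card (punctured_line ` {x :: 'a ^ 2. x \<noteq> 0 \<and> isotropic x})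
           + card {x :: 'a ^ 2. x \<noteq> 0 \<and> \<not> isotropic x}"
proof -
  let ?A = "{x \<in> C. isotropic x}" and ?B = "{x \<in> C. \<not> isotropic x}"
  have ind: "x = y" if "x \<in> C" "y \<in> C" "dot_prod x y = 0" for x y
    using C that by (auto simp: indep_TD_iff)
  have nz: "x \<noteq> 0" if "x \<in> C" for x using that C(1) by (auto simp: fst_TD)
  have "inj_on punctured_line ?A"
  proof (rule inj_onI)
    fix x y assume xy: "x \<in> ?A" "y \<in> ?A" "punctured_line x = punctured_line y"
    then have "y \<in> punctured_line (rot x)"
      using isotropic_iff_own_rot_line nz self_in_punctured_line by blast
    then show "x = y" using ind xy nz orthogonal_iff_on_rot_line by blast
  qed
  then have a: "card ?A \<le> card (punctured_line ` {x :: 'a ^ 2. x \<noteq> 0 \<and> isotropic x})"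
    using nz by (subst card_image[symmetric]) (auto intro!: card_mono)
  have "rot x \<noteq> y" if "x \<in> ?B" "y \<in> ?B" for x y
    using ind[of x y] that by (metis (mono_tags) dot_prod_rot_self isotropic_def mem_Collect_eq)
  then have "?B \<inter> rot ` ?B = {}" by blast
  then have "2 * card ?B = card (?B \<union> rot ` ?B)"
    by (simp add: card_Un_disjoint card_image inj_on_rot)
  also have "\<dots> \<le> card {x :: 'a ^ 2. x \<noteq> 0 \<and> \<not> isotropic x}"
    using nz by (intro card_mono) auto
  finally have b: "2 * card ?B \<le> \<dots>" .
  have "C = ?A \<union> ?B" by blast
  then have "card C = card ?A + card ?B"
    by (metis (no_types, lifting) card_Un_disjoint disjoint_iff finite_code mem_Collect_eq)
  with a b show ?thesis by simp
qed

text \<open>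
  Orthogonal isotropic vectors lie on the same line, so choosing one vector from each isotropic line
  produces no edge.
\<close>

lemma ex_indep_isotropic:
  obtains T :: "('a::{field,finite} ^ 2) set"
  where "\<And>x. x \<in> T \<Longrightarrow> x \<noteq> 0 \<and> isotropic x"
    "\<And>x y. x \<in> T \<Longrightarrow> y \<in> T \<Longrightarrow> x \<noteq> y \<Longrightarrow> dot_prod x y \<noteq> 0"
    "card T = card (punctured_line ` {x :: 'a ^ 2. x \<noteq> 0 \<and> isotropic x})"
proof -
  let ?I = "{x :: 'a ^ 2. x \<noteq> 0 \<and> isotropic x}"
  let ?g = "inv_into ?I punctured_line"
  define T where "T = ?g ` punctured_line ` ?I"
  have T: "x \<in> ?I" "?g (punctured_line x) = x" if "x \<in> T" for x
    using that unfolding T_def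
    by (metis (no_types, lifting) f_inv_into_f imageE inv_into_into)+
  show thesis
  proof (rule that[of T])
    show "card T = card (punctured_line ` ?I)"
      unfolding T_def by (intro card_image inj_on_inv_into) simp
    fix x y assume xy: "x \<in> T" "y \<in> T" "x \<noteq> y"
    show "dot_prod x y \<noteq> 0"
    proof
      assume "dot_prod x y = 0"
      then have "punctured_line y = punctured_line x"
        using orthogonal_iff_on_rot_line[of x y] isotropic_iff_own_rot_line[of x]
          punctured_line_eq[of y x] T(1)[OF xy(1)] T(1)[OF xy(2)] by simp
      then show False using T(2)[OF xy(1)] T(2)[OF xy(2)] xy(3) by argo
    qed
  qed (use T(1) in auto)
qed

text \<open>
  On the set of anisotropic lines the quarter turn is a fixed-point free involution that sends
  each line to its orthogonal complement. A transversal \<open>K\<close> of its orbits contains no two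
  orthogonal lines, so the union \<open>H\<close> of the lines in \<open>K\<close> has no edges. Here even the dot product of
  a vector with itself is nonzero. As \<open>H\<close> and its turned copy partition the anisotropic vectors, it
  contains half of them.
\<close>

lemma ex_indep_anisotropic:
  obtains H :: "('a::{field,finite} ^ 2) set"
  where "\<And>x. x \<in> H \<Longrightarrow> x \<noteq> 0 \<and> \<not> isotropic x"
    "\<And>x y. x \<in> H \<Longrightarrow> y \<in> H \<Longrightarrow> dot_prod x y \<noteq> 0"
    "2 * card H = card {x :: 'a ^ 2. x \<noteq> 0 \<and> \<not> isotropic x}"
proof -
  let ?N = "{x :: 'a ^ 2. x \<noteq> 0 \<and> \<not> isotropic x}"
  let ?S = "punctured_line ` ?N"
  obtain K where K: "K \<inter> (`) rot ` K = {}" "?S = K \<union> (`) rot ` K"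
  proof (rule involution_transversal[of ?S "(`) rot"])
    fix l assume "l \<in> ?S"
    then obtain x where x: "x \<in> ?N" "l = punctured_line x" by blast
    show "rot ` l \<in> ?S" using x by (auto simp: rot_image_punctured_line)
    show "rot ` rot ` l = l"
      by (simp add: x rot_image_punctured_line rot_rot punctured_line_uminus)
    show "rot ` l \<noteq> l" using x isotropic_iff_own_rot_line by (auto simp: rot_image_punctured_line)
  qed auto
  define H where "H = {x \<in> ?N. punctured_line x \<in> K}"
  have "x \<in> H \<union> rot ` H" if "x \<in> ?N" for x
  proof (cases "punctured_line x \<in> K")
    case False
    have "punctured_line x \<in> K \<union> (`) rot ` K"
      unfolding K(2)[symmetric] using that by (rule imageI)
    with False obtain l where l: "l \<in> K" "punctured_line x = rot ` l" by blast
    then obtain z where z: "z \<in> l" "x = rot z" using self_in_punctured_line by blast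
    obtain w where "l = punctured_line w" using l K(2) by blast
    then have "punctured_line z \<in> K" using punctured_line_eq[of z w] z l by simp
    then have "z \<in> H" using that z unfolding H_def by auto
    with z show ?thesis by blast
  qed (use that in \<open>auto simp: H_def\<close>)
  then have un: "?N = H \<union> rot ` H" unfolding H_def by auto
  have ort: "dot_prod x y \<noteq> 0" if "x \<in> H" "y \<in> H" for x y
  proof
    assume "dot_prod x y = 0"
    then have "punctured_line y = rot ` punctured_line x"
      using that orthogonal_iff_on_rot_line punctured_line_eq
      unfolding H_def rot_image_punctured_line by blast
    then show False using that K(1) unfolding H_def by blast
  qed
  have "H \<inter> rot ` H = {}" using ort by fastforce
  then have "card ?N = 2 * card H" by (simp add: un card_Un_disjoint card_image inj_on_rot)
  with ort show thesis by (intro that[of H]) (auto simp: H_def)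
qed

text \<open>
  The two independent sets can be united, since a vector orthogonal to an isotropic one lies on the
  same line and is isotropic too. Their union attains the upper bound of \<open>card_indep_TD_le\<close>.
\<close>

lemma double_independence_number_TD:
  "2 * independence_number (TD :: ('a::{field,finite} ^ 2) sgraph)
     = 2 * card (punctured_line ` {x :: 'a ^ 2. x \<noteq> 0 \<and> isotropic x})
       + card {x :: 'a ^ 2. x \<noteq> 0 \<and> \<not> isotropic x}"
proof -
  obtain T :: "('a ^ 2) set" where T: "\<And>x. x \<in> T \<Longrightarrow> x \<noteq> 0 \<and> isotropic x"
    "\<And>x y. x \<in> T \<Longrightarrow> y \<in> T \<Longrightarrow> x \<noteq> y \<Longrightarrow> dot_prod x y \<noteq> 0"
    "card T = card (punctured_line ` {x :: 'a ^ 2. x \<noteq> 0 \<and> isotropic x})"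
    using ex_indep_isotropic by blast
  obtain H :: "('a ^ 2) set" where H: "\<And>x. x \<in> H \<Longrightarrow> x \<noteq> 0 \<and> \<not> isotropic x"
    "\<And>x y. x \<in> H \<Longrightarrow> y \<in> H \<Longrightarrow> dot_prod x y \<noteq> 0"
    "2 * card H = card {x :: 'a ^ 2. x \<noteq> 0 \<and> \<not> isotropic x}"
    using ex_indep_anisotropic by blast
  have sub: "T \<union> H \<subseteq> fst TD" using T(1) H(1) by (auto simp: fst_TD)
  have mixed: "dot_prod x y \<noteq> 0" if "x \<in> T" "y \<in> H" for x y
  proof
    assume "dot_prod x y = 0"
    then have "y \<in> punctured_line (rot x)"
      using T(1) H(1) that orthogonal_iff_on_rot_line by blast
    then have "isotropic y \<longleftrightarrow> isotropic x" using isotropic_on_punctured_line by fastforce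
    then show False using T(1) H(1) that by blast
  qed
  have "indep (T \<union> H) (snd TD)"
    unfolding indep_TD_iff[OF sub] using T(2) H(2) mixed dot_prod_commute by (metis UnE)
  moreover have "T \<inter> H = {}" using T(1) H(1) by blast
  then have "card (T \<union> H) = card T + card H" by (simp add: card_Un_disjoint)
  ultimately have ex: "\<exists>C :: ('a ^ 2) set.
      C \<subseteq> fst TD \<and> indep C (snd TD) \<and> card C = card T + card H"
    using sub by blast
  have "independence_number (TD :: ('a ^ 2) sgraph) = card T + card H"
  proof (rule independence_number_eqI[OF ex])
    fix C :: "('a ^ 2) set"
    assume "C \<subseteq> fst TD" "indep C (snd TD)"
    from card_indep_TD_le[OF this] show "card C \<le> card T + card H" using T(3) H(3) by linarith
  qed
  then show ?thesis using T(3) H(3) by simp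
qed

theorem theorem4p1:
  shows "(CARD('a::{field,finite}) mod 4 = 3 \<longrightarrow>
            clique_number (TD :: ('a ^ 2) sgraph) = 2)
       \<and> (CARD('a) mod 4 \<noteq> 3 \<and> CARD('a) \<noteq> 2 \<longrightarrow>
            clique_number (TD :: ('a ^ 2) sgraph) = CARD('a) - 1)
       \<and> (num_isotropic TYPE('a ^ 2) \<noteq> 0 \<longrightarrow>
            real (independence_number (TD :: ('a ^ 2) sgraph))
              = real (num_isotropic TYPE('a ^ 2)) / (real CARD('a) - 1)
                + ((real CARD('a) ^ 2 - 1) - real (num_isotropic TYPE('a ^ 2))) / 2)
       \<and> (num_isotropic TYPE('a ^ 2) = 0 \<longrightarrow>
            real (independence_number (TD :: ('a ^ 2) sgraph))
              = (real CARD('a) ^ 2 - 1) / 2)"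
proof -
  let ?I = "{x :: 'a ^ 2. x \<noteq> 0 \<and> isotropic x}"
  let ?N = "{x :: 'a ^ 2. x \<noteq> 0 \<and> \<not> isotropic x}"
  let ?m = "card (punctured_line ` ?I)" and ?O = "num_isotropic TYPE('a ^ 2)"
  have m: "real ?m = real ?O / (real CARD('a) - 1)"
    unfolding num_isotropic_eq_lines
    using two_le_CARD_field[where 'a='a] by (simp add: of_nat_diff)
  have "card (?I \<union> ?N) = card ?I + card ?N" by (rule card_Un_disjoint) auto
  moreover have "?I \<union> ?N = UNIV - {0}" by blast
  moreover have "CARD('a ^ 2) = Suc (card (UNIV - {0 :: 'a ^ 2}))"
    by (rule card.remove) auto
  ultimately have "CARD('a) ^ 2 = ?O + card ?N + 1"
    by (simp add: num_isotropic_eq_card)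
  then have "real CARD('a) ^ 2 = real (?O + card ?N + 1)"
    by (simp only: of_nat_power[symmetric])
  then have n: "real (card ?N) = real CARD('a) ^ 2 - 1 - real ?O" by simp
  have "2 * real (independence_number (TD :: ('a ^ 2) sgraph)) = 2 * real ?m + real (card ?N)"
    using double_independence_number_TD[where 'a='a] by linarith
  then have alpha: "real (independence_number (TD :: ('a ^ 2) sgraph))
      = real ?O / (real CARD('a) - 1) + ((real CARD('a) ^ 2 - 1) - real ?O) / 2"
    by (simp add: m n field_simps)
  show ?thesis
    using clique_number_TD_anisotropic[where 'a='a] clique_number_TD_isotropic[where 'a='a] alpha
    by auto
qed

end
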